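(* Suppose $\xi_1>0>\xi_2$, and let $s_H:=\xi_1/(\xi_1-\xi_2)$. Then the following hold. 1. If $c_1/p_1<\min\{P,\,c_2/p_2\}$, then $(i^*,s^* )=(1,0)$ is a provider-optimal policy. 2. If $P<\min\{c_1/p_1,\,(c_2-c_1)/(p_2-p_1)\}$, then $(i^*,s^* )=(1,s)$ is a provider-optimal policy for any $s\in[s_H,1]$. 3. If $(c_2-c_1)/(p_2-p_1)<P<c_2/p_2<c_1/p_1$, then $(i^*,s^* )=(2,0)$ is a provider-optimal policy.
   Context: Two models $M_1,M_2$ have success probabilities $0<p_1<p_2<1$, user latencies $t_1<t_2$ in $[0,1]$, and provider costs $c_1<c_2$ in $[0,1]$. A success is worth $V>0$ to the user, abandonment costs the provider a penalty $P>0$, and $\xi_i:=Vp_i-t_i$ for $i\in\{1,2\}$. A provider policy is a pair $(i,s)$ with $i\in\{1,2\}$ the initial model and $s\in[0,1]$ the probability of cascading from $M_1$ to $M_2$ after a failure of $M_1$ (if $i=2$ the value of $s$ is irrelevant and the policy is written $(2,0)$). The user chooses an abandonment probability $q\in[0,1]$. Let $\alpha(q):=(1-p_1)(1-q)$, $\beta(q):=\frac{1}{p_2+(1-p_2)q}$, and $$S_1(s,q)=\tfrac{p_1+\alpha(q)\beta(q)p_2 s}{1-\alpha(q)(1-s)},\quad L_1(s,q)=\tfrac{t_1+\alpha(q)\beta(q)t_2 s}{1-\alpha(q)(1-s)},\quad C_1(s,q)=\tfrac{c_1+\alpha(q)\beta(q)c_2 s}{1-\alpha(q)(1-s)},$$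 $$S_2(s,q)=\beta(q)p_2,\quad L_2(s,q)=\beta(q)t_2,\quad C_2(s,q)=\beta(q)c_2$$ (success probability, expected latency, expected service cost). User utility: $U_i(s,q):=VS_i(s,q)-L_i(s,q)$. Provider cost: $J_i(s,q):=C_i(s,q)+P(1-S_i(s,q))$. The user best response is $q^*(i,s)\in\arg\max_{q\in[0,1]}U_i(s,q)$. A policy $(i^*,s^* )$ is provider-optimal if it minimizes $J_i(s,q^*(i,s))$ over all $(i,s)\in\{1,2\}\times[0,1]$. *)

theory Defs
  imports Complex_Main
begin

datatype model = M1 | M2

text \<open>
  \<open>p\<close>, \<open>t\<close>, \<open>c\<close> are the success probabilities, user latencies and provider costs of the models;
  \<open>s\<close> is the cascading probability and \<open>q\<close> the user's abandonment probability.
\<close>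

definition alpha :: "(model \<Rightarrow> real) \<Rightarrow> real \<Rightarrow> real"
  where "alpha p q = (1 - p M1) * (1 - q)"

definition beta :: "(model \<Rightarrow> real) \<Rightarrow> real \<Rightarrow> real"
  where "beta p q = 1 / (p M2 + (1 - p M2) * q)"

primrec success :: "(model \<Rightarrow> real) \<Rightarrow> model \<Rightarrow> real \<Rightarrow> real \<Rightarrow> real" where
  "success p M1 s q = (p M1 + alpha p q * beta p q * p M2 * s) / (1 - alpha p q * (1 - s))"
| "success p M2 s q = beta p q * p M2"

primrec latency :: "(model \<Rightarrow> real) \<Rightarrow> (model \<Rightarrow> real) \<Rightarrow> model \<Rightarrow> real \<Rightarrow> real \<Rightarrow> real" where
  "latency p t M1 s q = (t M1 + alpha p q * beta p q * t M2 * s) / (1 - alpha p q * (1 - s))"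
| "latency p t M2 s q = beta p q * t M2"

primrec service_cost :: "(model \<Rightarrow> real) \<Rightarrow> (model \<Rightarrow> real) \<Rightarrow> model \<Rightarrow> real \<Rightarrow> real \<Rightarrow> real" where
  "service_cost p c M1 s q = (c M1 + alpha p q * beta p q * c M2 * s) / (1 - alpha p q * (1 - s))"
| "service_cost p c M2 s q = beta p q * c M2"

definition user_utility ::
    "real \<Rightarrow> (model \<Rightarrow> real) \<Rightarrow> (model \<Rightarrow> real) \<Rightarrow> model \<Rightarrow> real \<Rightarrow> real \<Rightarrow> real"
  where "user_utility V p t i s q = V * success p i s q - latency p t i s q"

definition provider_cost ::
    "real \<Rightarrow> (model \<Rightarrow> real) \<Rightarrow> (model \<Rightarrow> real) \<Rightarrow> model \<Rightarrow> real \<Rightarrow> real \<Rightarrow> real"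
  where "provider_cost P p c i s q = service_cost p c i s q + P * (1 - success p i s q)"

text \<open>\<open>qs\<close> selects one best response for every policy; no tie-breaking rule is imposed.\<close>

definition user_best_response ::
    "real \<Rightarrow> (model \<Rightarrow> real) \<Rightarrow> (model \<Rightarrow> real) \<Rightarrow> (model \<Rightarrow> real \<Rightarrow> real) \<Rightarrow> bool"
  where "user_best_response V p t qs \<longleftrightarrow>
    (\<forall>i. \<forall>s\<in>{0..1}. is_arg_max (user_utility V p t i s) (\<lambda>q. q \<in> {0..1}) (qs i s))"

definition policies :: "(model \<times> real) set"
  where "policies = UNIV \<times> {0..1}"

definition provider_optimal ::
    "real \<Rightarrow> (model \<Rightarrow> real) \<Rightarrow> (model \<Rightarrow> real) \<Rightarrow> (model \<Rightarrow> real \<Rightarrow> real) \<Rightarrow> model \<times> real \<Rightarrow> bool"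
  where "provider_optimal P p c qs =
    is_arg_min (\<lambda>(i, s). provider_cost P p c i s (qs i s)) (\<lambda>\<pi>. \<pi> \<in> policies)"

definition xi :: "real \<Rightarrow> (model \<Rightarrow> real) \<Rightarrow> (model \<Rightarrow> real) \<Rightarrow> model \<Rightarrow> real"
  where "xi V p t i = V * p i - t i"

definition s_H :: "real \<Rightarrow> (model \<Rightarrow> real) \<Rightarrow> (model \<Rightarrow> real) \<Rightarrow> real"
  where "s_H V p t = xi V p t M1 / (xi V p t M1 - xi V p t M2)"

lemma ex_user_best_response:
  assumes "0 < p M1" "p M1 < 1" "0 < p M2" "p M2 < 1"
  shows "\<exists>qs. user_best_response V p t qs"
proof -
  have "\<exists>q. is_arg_max (user_utility V p t i s) (\<lambda>q. q \<in> {0..1}) q" if s: "s \<in> {0..1}" for i s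
  proof -
    have b: "p M2 + (1 - p M2) * q \<noteq> 0" if "q \<in> {0..1}" for q
    proof -
      have "0 \<le> (1 - p M2) * q" using that assms by simp
      then show ?thesis using assms by linarith
    qed
    have d: "1 - alpha p q * (1 - s) \<noteq> 0" if "q \<in> {0..1}" for q
    proof -
      have "(1 - q) * (1 - s) \<le> 1" using that s by (intro mult_le_one) auto
      then have "(1 - p M1) * ((1 - q) * (1 - s)) \<le> (1 - p M1) * 1"
        using assms by (intro mult_left_mono) auto
      then have "alpha p q * (1 - s) \<le> 1 - p M1" by (simp add: alpha_def mult.assoc)
      then show ?thesis using assms by linarith
    qed
    have ca: "continuous_on {0..1} (alpha p)"
      unfolding alpha_def by (intro continuous_intros)
    have cb: "continuous_on {0..1} (beta p)"
      unfolding beta_def using b by (intro continuous_intros) auto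
    have "continuous_on {0..1} (user_utility V p t i s)"
      unfolding user_utility_def using d
      by (cases i; simp; intro continuous_intros ca cb) auto
    then obtain q where "q \<in> {0..1}"
        and "\<forall>r\<in>{0..1}. user_utility V p t i s r \<le> user_utility V p t i s q"
      using continuous_attains_sup[of "{0..1::real}" "user_utility V p t i s"] by auto
    then show ?thesis unfolding is_arg_max_linorder by blast
  qed
  then have "\<forall>i. \<forall>s\<in>{0..1}. is_arg_max (user_utility V p t i s) (\<lambda>q. q \<in> {0..1})
      (SOME q. is_arg_max (user_utility V p t i s) (\<lambda>q. q \<in> {0..1}) q)"
    by (blast intro: someI_ex)
  then show ?thesis
    unfolding user_best_response_def
    by (intro exI[of _ "\<lambda>i s. SOME q. is_arg_max (user_utility V p t i s) (\<lambda>q. q \<in> {0..1}) q"])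
qed

end

theory Submission
  imports Defs
begin

text \<open>
  Put \<open>d\<^sub>i = c\<^sub>i - P p\<^sub>i\<close>. Up to the constant \<open>P\<close>, the provider's cost is obtained from the
  user's utility by replacing \<open>\<xi>\<^sub>i\<close> with \<open>d\<^sub>i\<close>. The best responses are needed only at the
  claimed optima and for the second model: there the user never abandons (policy \<open>(1,0)\<close>) or
  abandons at once (\<open>s \<ge> s\<^sub>H\<close>, or the second model). These give the cost offsets \<open>d\<^sub>1/p\<^sub>1\<close>,
  \<open>d\<^sub>1\<close> and \<open>d\<^sub>2\<close>, and in its regime each of them bounds the cost of any policy starting with the first model
  from below, whatever the user does.
\<close>

lemma alpha_bounds:
  assumes "p M1 \<le> 1" "q \<in> {0..1}"
  shows "0 \<le> alpha p q" "alpha p q \<le> 1 - p M1"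
  using assms mult_left_mono[of "1 - q" 1 "1 - p M1"] by (auto simp: alpha_def)

lemma beta_denominator_bounds:
  fixes q :: real
  assumes "p M2 \<le> 1" "q \<in> {0..1}"
  shows "p M2 \<le> p M2 + (1 - p M2) * q" "p M2 + (1 - p M2) * q \<le> 1"
  using assms mult_left_mono[of q 1 "1 - p M2"] by auto

lemma beta_bounds:
  assumes "0 < p M2" "p M2 \<le> 1" "q \<in> {0..1}"
  shows "1 \<le> beta p q" "beta p q * p M2 \<le> 1"
  using beta_denominator_bounds[of p q] assms by (auto simp: beta_def field_simps)

text \<open>Strictness for \<open>q < 1\<close> makes immediate abandonment the only best response
  wherever this is used, so ties never arise.\<close>

lemma beta_gt_one:
  assumes "0 < p M2" "p M2 < 1" "0 \<le> q" "q < 1"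
  shows "1 < beta p q"
proof -
  have "0 < (1 - p M2) * (1 - q)"
    using assms by simp
  then have "p M2 + (1 - p M2) * q < 1"
    by (simp add: algebra_simps)
  moreover have "0 < p M2 + (1 - p M2) * q"
    using assms by (simp add: add_pos_nonneg)
  ultimately show ?thesis
    by (simp add: beta_def)
qed

lemma cascade_denominator_bounds:
  assumes "0 < p M1" "p M1 \<le> 1" "s \<in> {0..1}" "q \<in> {0..1}"
  shows "p M1 \<le> 1 - alpha p q * (1 - s)" "1 - alpha p q * (1 - s) \<le> 1"
proof -
  have "alpha p q * (1 - s) \<le> alpha p q * 1"
    using alpha_bounds[of p q] assms by (intro mult_left_mono) auto
  then show "p M1 \<le> 1 - alpha p q * (1 - s)"
    using alpha_bounds[of p q] assms by simp
  show "1 - alpha p q * (1 - s) \<le> 1"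
    using alpha_bounds[of p q] assms by simp
qed

lemma user_utility_M1:
  "user_utility V p t M1 s q =
    (xi V p t M1 + alpha p q * beta p q * s * xi V p t M2) / (1 - alpha p q * (1 - s))"
  by (simp add: user_utility_def xi_def diff_divide_distrib[symmetric] algebra_simps)

lemma user_utility_M2: "user_utility V p t M2 s q = beta p q * xi V p t M2"
  by (simp add: user_utility_def xi_def algebra_simps)

lemma provider_cost_M1:
  "provider_cost P p c M1 s q =
    P + (c M1 - P * p M1 + alpha p q * beta p q * s * (c M2 - P * p M2)) / (1 - alpha p q * (1 - s))"
proof -
  have "provider_cost P p c M1 s q =
      P + ((c M1 + alpha p q * beta p q * c M2 * s) - P * (p M1 + alpha p q * beta p q * p M2 * s))
        / (1 - alpha p q * (1 - s))"
    by (simp only: provider_cost_def service_cost.simps success.simps diff_divide_distrib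
        right_diff_distrib times_divide_eq_right)
  then show ?thesis
    by (simp add: algebra_simps)
qed

lemma provider_cost_M2:
  "provider_cost P p c M2 s q = P + beta p q * (c M2 - P * p M2)"
  by (simp add: provider_cost_def algebra_simps)

lemma alpha_one [simp]: "alpha p 1 = 0"
  by (simp add: alpha_def)

lemma beta_one [simp]: "beta p 1 = 1"
  by (simp add: beta_def)

lemma user_best_responseD:
  assumes "user_best_response V p t qs" "s \<in> {0..1}"
  shows "qs i s \<in> {0..1}"
    and "r \<in> {0..1} \<Longrightarrow> user_utility V p t i s r \<le> user_utility V p t i s (qs i s)"
  using assms by (auto simp: user_best_response_def is_arg_max_linorder)

lemma best_response_M2:
  assumes "user_best_response V p t qs" "s \<in> {0..1}" "0 < p M2" "p M2 < 1" "xi V p t M2 < 0"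
  shows "qs M2 s = 1"
proof (rule ccontr)
  assume "qs M2 s \<noteq> 1"
  then have "1 < beta p (qs M2 s)"
    using user_best_responseD(1)[OF assms(1,2), of M2] assms by (intro beta_gt_one) auto
  then show False
    using user_best_responseD(2)[OF assms(1,2), of 1 M2] assms by (simp add: user_utility_M2)
qed

text \<open>Without cascading the utility is
  \<open>\<xi>\<^sub>1 / (p\<^sub>1 + (1 - p\<^sub>1) q)\<close>, strictly decreasing in
  \<open>q\<close>.\<close>

lemma best_response_M1_0:
  assumes "user_best_response V p t qs" "0 < p M1" "p M1 < 1" "0 < xi V p t M1"
  shows "qs M1 0 = 0"
proof (rule ccontr)
  let ?q = "qs M1 0"
  assume "?q \<noteq> 0"
  moreover have q: "?q \<in> {0..1}"
    using user_best_responseD(1)[OF assms(1)] by simp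
  ultimately have "0 < (1 - p M1) * ?q"
    using assms by simp
  then have "p M1 < 1 - alpha p ?q"
    by (simp add: alpha_def algebra_simps)
  then have "xi V p t M1 / (1 - alpha p ?q) < xi V p t M1 / p M1"
    using assms by (intro divide_strict_left_mono) auto
  moreover have "alpha p 0 = 1 - p M1"
    by (simp add: alpha_def)
  ultimately show False
    using user_best_responseD(2)[OF assms(1), of 0 0 M1] by (simp add: user_utility_M1)
qed

text \<open>
  The threshold \<open>s\<^sub>H\<close> is where \<open>(1 - s) \<xi>\<^sub>1 + s \<xi>\<^sub>2\<close> changes sign. Abandoning at once yields
  \<open>\<xi>\<^sub>1\<close>, and abandoning with probability \<open>q\<close> improves on it iff
  \<open>\<alpha> ((1 - s) \<xi>\<^sub>1 + \<beta> s \<xi>\<^sub>2) > 0\<close>, where \<open>\<beta> > 1\<close> for \<open>q < 1\<close>.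
\<close>
lemma best_response_M1_high:
  assumes "user_best_response V p t qs" "0 < p M1" "p M1 < 1" "0 < p M2" "p M2 < 1"
    and "0 < xi V p t M1" "xi V p t M2 < 0" "s \<in> {s_H V p t..1}"
  shows "qs M1 s = 1"
proof (rule ccontr)
  let ?q = "qs M1 s" and ?x1 = "xi V p t M1" and ?x2 = "xi V p t M2"
  assume "?q \<noteq> 1"
  \<comment> \<open>At \<open>s = s_H\<close> the mixture below can vanish; \<open>s > 0\<close>
    lets the factor \<beta> > 1 still make it strictly negative.\<close>
  have "0 < s_H V p t"
    using assms by (simp add: s_H_def)
  then have s: "0 < s" "s \<in> {0..1}"
    using assms by auto
  have q: "?q \<in> {0..1}" "?q < 1"
    using user_best_responseD(1)[OF assms(1) s(2), of M1] \<open>?q \<noteq> 1\<close> by auto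
  have "(1 - s) * ?x1 + s * ?x2 \<le> 0"
    using assms by (simp add: s_H_def pos_divide_le_eq algebra_simps)
  moreover have "beta p ?q * (s * ?x2) < 1 * (s * ?x2)"
    using beta_gt_one[of p ?q] q s assms
    by (intro mult_strict_right_mono_neg) (auto simp: mult_less_0_iff)
  ultimately have "(1 - s) * ?x1 + beta p ?q * s * ?x2 < 0"
    by (simp add: mult.assoc)
  moreover have "0 < alpha p ?q"
    using q assms by (simp add: alpha_def)
  ultimately have "alpha p ?q * ((1 - s) * ?x1 + beta p ?q * s * ?x2) < 0"
    by (simp add: mult_pos_neg)
  moreover have "0 < 1 - alpha p ?q * (1 - s)"
    using cascade_denominator_bounds(1)[of p s ?q] q s assms by auto
  ultimately have "user_utility V p t M1 s ?q < ?x1"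
    by (simp add: user_utility_M1 pos_divide_less_eq algebra_simps)
  then show False
    using user_best_responseD(2)[OF assms(1) s(2), of 1 M1] by (simp add: user_utility_M1)
qed

text \<open>As \<beta> \<open>p\<^sub>2\<close> \<le> 1, the numerator is at most
  \<open>p\<^sub>1\<close> + \<alpha> s, and \<open>p\<^sub>1\<close> \<le> 1 - \<alpha>.\<close>

lemma success_M1_le_one:
  assumes "0 < p M1" "p M1 \<le> 1" "0 < p M2" "p M2 \<le> 1" "s \<in> {0..1}" "q \<in> {0..1}"
  shows "success p M1 s q \<le> 1"
proof -
  have "(beta p q * p M2) * (alpha p q * s) \<le> 1 * (alpha p q * s)"
    using assms alpha_bounds[of p q] beta_bounds[of p q] by (intro mult_right_mono) auto
  then have "p M1 + alpha p q * beta p q * p M2 * s \<le> 1 - alpha p q * (1 - s)"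
    using alpha_bounds[of p q] assms by (simp add: algebra_simps)
  then show ?thesis
    using cascade_denominator_bounds(1)[of p s q] assms by simp
qed

text \<open>The bound is \<open>d\<^sub>1/p\<^sub>1\<close> times the success probability, since \<open>d\<^sub>2 \<ge> p\<^sub>2 (d\<^sub>1/p\<^sub>1)\<close>.\<close>
lemma provider_cost_M1_ge_ratio:
  assumes "0 < p M1" "p M1 \<le> 1" "0 < p M2" "p M2 \<le> 1" "s \<in> {0..1}" "q \<in> {0..1}"
    and "c M1 / p M1 \<le> P" "c M1 / p M1 \<le> c M2 / p M2"
  shows "c M1 / p M1 \<le> provider_cost P p c M1 s q"
proof -
  let ?k = "c M1 / p M1 - P" and ?ab = "alpha p q * beta p q"
  have D: "0 < 1 - alpha p q * (1 - s)"
    using cascade_denominator_bounds(1)[of p s q] assms by auto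
  \<comment> \<open>Since \<open>?k\<close> \<le> 0, scaling it by a factor of at most 1 cannot
    lower it.\<close>
  have "?k \<le> ?k * success p M1 s q"
    using success_M1_le_one[of p, OF assms(1-6)] assms(7) mult_left_mono_neg[of "success p M1 s q" 1 ?k]
    by simp
  also have "\<dots> = (p M1 * ?k + ?ab * s * (p M2 * ?k)) / (1 - alpha p q * (1 - s))"
    by (simp only: success.simps times_divide_eq_right) (simp only: algebra_simps)
  also have "p M1 * ?k = c M1 - P * p M1"
    using assms(1) by (simp add: field_simps)
  also have "(c M1 - P * p M1 + ?ab * s * (p M2 * ?k)) / (1 - alpha p q * (1 - s)) \<le>
      (c M1 - P * p M1 + ?ab * s * (c M2 - P * p M2)) / (1 - alpha p q * (1 - s))"
  proof (intro divide_right_mono add_left_mono mult_left_mono)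
    have "p M2 * (c M1 / p M1) \<le> p M2 * (c M2 / p M2)"
      using assms by (intro mult_left_mono) auto
    then show "p M2 * ?k \<le> c M2 - P * p M2"
      using assms(3) by (simp add: algebra_simps)
    show "0 \<le> ?ab * s"
      using alpha_bounds[of p q] beta_bounds[of p q] assms by simp
  qed (use D in simp)
  finally show ?thesis
    by (simp add: provider_cost_M1)
qed

text \<open>The cascading term only adds to the numerator, and dividing by a positive number of at
  most 1 cannot lower a nonnegative value. Keeping \<open>d\<close> free covers both
  \<open>d\<^sub>1\<close> and \<open>d\<^sub>2\<close>.\<close>

lemma provider_cost_M1_ge_offset:
  assumes "0 < p M1" "p M1 \<le> 1" "0 < p M2" "p M2 \<le> 1" "s \<in> {0..1}" "q \<in> {0..1}"
    and "0 \<le> d" "d \<le> c M1 - P * p M1" "0 \<le> c M2 - P * p M2"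
  shows "P + d \<le> provider_cost P p c M1 s q"
proof -
  note D = cascade_denominator_bounds[of p, OF assms(1,2,5,6)]
  have "0 \<le> alpha p q * beta p q * s * (c M2 - P * p M2)"
    using alpha_bounds[of p q] beta_bounds[of p q] assms by simp
  moreover have "d * (1 - alpha p q * (1 - s)) \<le> d * 1"
    using D(2) assms by (intro mult_left_mono) auto
  ultimately have "d * (1 - alpha p q * (1 - s)) \<le>
      c M1 - P * p M1 + alpha p q * beta p q * s * (c M2 - P * p M2)"
    using assms by linarith
  then show ?thesis
    using D(1) assms by (simp add: provider_cost_M1 pos_le_divide_eq)
qed

lemma provider_optimalI:
  assumes "s \<in> {0..1}" "provider_cost P p c i s (qs i s) = v"
    and "\<And>r. r \<in> {0..1} \<Longrightarrow> v \<le> provider_cost P p c M1 r (qs M1 r)"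
    and "\<And>r. r \<in> {0..1} \<Longrightarrow> v \<le> provider_cost P p c M2 r (qs M2 r)"
  shows "provider_optimal P p c qs (i, s)"
proof -
  have "v \<le> provider_cost P p c j r (qs j r)" if "r \<in> {0..1}" for j r
    using assms(3,4) that by (cases j) auto
  then show ?thesis
    using assms(1,2) by (auto simp: provider_optimal_def is_arg_min_linorder policies_def)
qed

theorem theorem5:
  fixes p t c :: "model \<Rightarrow> real" and V P :: real and qs :: "model \<Rightarrow> real \<Rightarrow> real"
  assumes "0 < p M1" and "p M1 < p M2" and "p M2 < 1"
    and "0 \<le> t M1" and "t M1 < t M2" and "t M2 \<le> 1"
    and "0 \<le> c M1" and "c M1 < c M2" and "c M2 \<le> 1"
    and "0 < V" and "0 < P"
    and "user_best_response V p t qs"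
    and "xi V p t M1 > 0" and "0 > xi V p t M2"
  shows "(c M1 / p M1 < min P (c M2 / p M2)
            \<longrightarrow> provider_optimal P p c qs (M1, 0))
       \<and> (P < min (c M1 / p M1) ((c M2 - c M1) / (p M2 - p M1))
            \<longrightarrow> (\<forall>s\<in>{s_H V p t..1}. provider_optimal P p c qs (M1, s)))
       \<and> ((c M2 - c M1) / (p M2 - p M1) < P \<and> P < c M2 / p M2 \<and> c M2 / p M2 < c M1 / p M1
            \<longrightarrow> provider_optimal P p c qs (M2, 0))"
proof -
  have p: "0 < p M1" "p M1 < 1" "0 < p M2" "p M2 < 1"
    using assms by auto
  note br = \<open>user_best_response V p t qs\<close>
  have q01: "qs i s \<in> {0..1}" if "s \<in> {0..1}" for i s
    using user_best_responseD(1)[OF br that] .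
  have cost2: "provider_cost P p c M2 s (qs M2 s) = P + (c M2 - P * p M2)" if "s \<in> {0..1}" for s
    using best_response_M2[OF br that p(3,4)] assms by (simp add: provider_cost_M2)
  have "provider_optimal P p c qs (M1, 0)" if "c M1 / p M1 < min P (c M2 / p M2)"
  proof (rule provider_optimalI)
    show "provider_cost P p c M1 0 (qs M1 0) = c M1 / p M1"
      using best_response_M1_0[OF br p(1,2)] assms p
      by (simp add: provider_cost_M1 alpha_def field_simps)
    show "c M1 / p M1 \<le> provider_cost P p c M1 r (qs M1 r)" if "r \<in> {0..1}" for r
      using \<open>c M1 / p M1 < _\<close> p that q01[OF that] by (intro provider_cost_M1_ge_ratio) auto
    show "c M1 / p M1 \<le> provider_cost P p c M2 r (qs M2 r)" if "r \<in> {0..1}" for r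
    proof -
      let ?k = "c M1 / p M1"
      \<comment> \<open>The cost here is \<open>c\<^sub>2 + P (1 - p\<^sub>2)\<close>; split
        \<open>?k\<close> with weights \<open>p\<^sub>2\<close> and \<open>1 - p\<^sub>2\<close> and
        compare term by term.\<close>
      have "?k * p M2 \<le> c M2"
        using \<open>?k < _\<close> p by (simp add: pos_less_divide_eq)
      moreover have "?k * (1 - p M2) \<le> P * (1 - p M2)"
        using \<open>?k < _\<close> p by (intro mult_right_mono) auto
      ultimately show ?thesis
        unfolding cost2[OF that] by (simp only: algebra_simps)
    qed
  qed simp
  moreover have "provider_optimal P p c qs (M1, s)"
    if P: "P < min (c M1 / p M1) ((c M2 - c M1) / (p M2 - p M1))" and s: "s \<in> {s_H V p t..1}" for s
  proof (rule provider_optimalI)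
    \<comment> \<open>The offsets \<open>d\<^sub>1\<close> and \<open>d\<^sub>2\<close> coincide
      when \<open>P\<close> is the incremental cost per unit of success; below that value
      \<open>d\<^sub>1\<close> is the smaller.\<close>
    have d: "0 \<le> c M1 - P * p M1" "c M1 - P * p M1 \<le> c M2 - P * p M2"
      using P assms p by (auto simp: pos_less_divide_eq algebra_simps)
    have "0 < s_H V p t"
      using assms by (simp add: s_H_def)
    then show "s \<in> {0..1}"
      using s by auto
    show "provider_cost P p c M1 s (qs M1 s) = P + (c M1 - P * p M1)"
      using best_response_M1_high[OF br p _ _ s] assms by (simp add: provider_cost_M1)
    show "P + (c M1 - P * p M1) \<le> provider_cost P p c M1 r (qs M1 r)" if "r \<in> {0..1}" for r
      using d p that q01[OF that] by (intro provider_cost_M1_ge_offset) auto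
    show "P + (c M1 - P * p M1) \<le> provider_cost P p c M2 r (qs M2 r)" if "r \<in> {0..1}" for r
      using d cost2[OF that] by simp
  qed
  moreover have "provider_optimal P p c qs (M2, 0)"
    if P: "(c M2 - c M1) / (p M2 - p M1) < P" "P < c M2 / p M2"
  proof (rule provider_optimalI)
    \<comment> \<open>Above the incremental ratio the order flips, so \<open>d\<^sub>2\<close> is
      the smaller nonnegative offset.\<close>
    have d: "0 \<le> c M2 - P * p M2" "c M2 - P * p M2 \<le> c M1 - P * p M1"
      using P assms p by (auto simp: pos_less_divide_eq pos_divide_less_eq algebra_simps)
    show "P + (c M2 - P * p M2) \<le> provider_cost P p c M1 r (qs M1 r)" if "r \<in> {0..1}" for r
      using d p that q01[OF that] by (intro provider_cost_M1_ge_offset) auto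
  qed (simp_all add: cost2)
  ultimately show ?thesis
    by blast
qed

end
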